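(* Let $p(z)=a_0z^n+a_1z^{n-1}+\cdots+a_n$ and $q(z)=b_0z^n+b_1z^{n-1}+\cdots+b_n$ be polynomials with complex coefficients, $a_0\neq 0$, with $\deg p=n$ and $\deg q=m\le n-1$ (so $b_0=\cdots=b_{n-m-1}=0$, $b_{n-m}\ne0$). Then the resultant of $p$ and $q$ can be computed as $$\mathbf{R}(p,q)=(-1)^{\frac{n(n-1)}{2}}\,a_0^{m+n}\prod_{1\le i<k\le 2n}(z_i+z_k),$$ where $z_1,\ldots,z_{2n}$ are the zeros, listed with multiplicity, of the polynomial of degree $2n$ $$h(z)=p(z^2)+z\,q(z^2).$$
   Context: The resultant $\mathbf{R}(p,q)$ of $p$ (degree $n$) and $q$ (degree $m$) is the determinant of the $(n+m)\times(n+m)$ matrix whose first $m$ rows are the coefficient row $(a_0,a_1,\ldots,a_n,0,\ldots,0)$ shifted to the right by $0,1,\ldots,m-1$ positions, and whose last $n$ rows are the coefficient row $(b_{n-m},b_{n-m+1},\ldots,b_n,0,\ldots,0)$ shifted to the right by $0,1,\ldots,n-1$ positions.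
   Formalization: The sign (-1)^{n(n-1)/2} is corrected to (-1)^{n(n+1)/2}; the printed sign fails for odd n: for p=z, q=1 the resultant is 1, but h=z^2+z has zeros 0 and -1, so the printed formula gives -1. *)

theory Defs
  imports "Subresultants.Resultant_Prelim"
begin

text \<open>
  For \<open>deg p = n\<close> and \<open>deg q = m\<close>, the first \<open>m\<close> rows of \<^const>\<open>sylvester_mat\<close> \<open>p q\<close> are the
  shifted coefficient rows of \<open>p\<close> and the last \<open>n\<close> rows those of \<open>q\<close>, each starting with the
  leading coefficient, so \<^const>\<open>resultant\<close> \<open>p q\<close> is the determinant of exactly this matrix.

  With this convention the sign relating the resultant to the product of the sums
  \<open>z\<^sub>i + z\<^sub>k\<close> of the zeros of \<open>h(z) = p(z^2) + z q(z^2)\<close> is \<open>(-1)^(n(n+1)/2)\<close>, and not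
  \<open>(-1)^(n(n-1)/2)\<close>; the two differ for odd \<open>n\<close>. For \<open>p = z\<close> and \<open>q = 1\<close> the resultant is \<open>1\<close>,
  while \<open>h = z^2 + z\<close> has the zeros \<open>0\<close> and \<open>-1\<close>, whose sum is \<open>-1\<close>.
\<close>

end

theory Submission
  imports Defs "Subresultants.Subresultant" "HOL-Computational_Algebra.Fundamental_Theorem_Algebra"
begin

text \<open>
  Normalise \<open>a\<^sub>0 = 1\<close>, so that the resultant is the product of \<open>q\<close> over the zeros of \<open>p\<close>,
  and build \<open>h\<close> from its zeros one at a time. Multiplying \<open>P(z^2) + z Q(z^2)\<close> by \<open>z - c\<close>
  replaces \<open>(P, Q)\<close> by \<open>(P', Q') = (x Q - c P, P - c Q)\<close>, \<open>x = z^2\<close>. Since \<open>P' + c Q' = (x - c^2) Q\<close>,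
  this step multiplies the resultant of the two parts by \<open>Q'(c^2)\<close> up to sign. Here \<open>Q'(c^2)\<close> is
  the value of the old polynomial at \<open>-c\<close>, hence up to sign the product of the \<open>c + z\<^sub>i\<close> over its
  zeros. The signs of the steps from \<open>2k\<close> to \<open>2k + 2\<close> zeros contribute \<open>(-1)^(k+1)\<close>.
\<close>

section \<open>Zeros and linear factors over an algebraically closed field\<close>

lemma proots_prod_linear: "proots (\<Prod>x\<in>#A. [:-x, 1:]) = (A :: 'a :: idom multiset)"
proof (induction A)
  case (add a A)
  have "(\<Prod>x\<in>#A. [:-x, 1:]) \<noteq> 0"
    by (auto simp: prod_mset_zero_iff)
  then have "proots ([:-a, 1:] * (\<Prod>x\<in>#A. [:-x, 1:])) = proots [:-a, 1:] + A"
    using add.IH by (subst proots_mult) auto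
  also have "proots [:-a, 1:] = {#a#}"
    using proots_linear_factor[of "-a"] by simp
  finally show ?case by simp
qed simp

lemma
  fixes p :: "'a :: alg_closed_field poly"
  shows size_proots_alg_closed: "size (proots p) = degree p"
    and alg_closed_decompose: "p = smult (lead_coeff p) (\<Prod>x\<in>#proots p. [:-x, 1:])"
proof -
  have "size (proots p) = degree p \<and> p = smult (lead_coeff p) (\<Prod>x\<in>#proots p. [:-x, 1:])"
  proof (cases "p = 0")
    case False
    then obtain A where A: "size A = degree p" "p = smult (lead_coeff p) (\<Prod>x\<in>#A. [:-x, 1:])"
      using alg_closed_imp_factorization by blast
    have "proots p = A"
      by (subst A(2)) (use False proots_prod_linear[of A] in simp)
    with A show ?thesis by simp
  qed simp
  then show "size (proots p) = degree p" "p = smult (lead_coeff p) (\<Prod>x\<in>#proots p. [:-x, 1:])"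
    by blast+
qed

lemma poly_eq_prod_proots:
  "poly p x = lead_coeff p * (\<Prod>y\<in>#proots p. x - y)" for p :: "'a :: alg_closed_field poly"
proof -
  have "poly p x = poly (smult (lead_coeff p) (\<Prod>y\<in>#proots p. [:-y, 1:])) x"
    by (subst alg_closed_decompose[of p]) (rule refl)
  also have "\<dots> = lead_coeff p * (\<Prod>y\<in>#proots p. x - y)"
    by (simp add: poly_prod_mset image_mset.compositionality o_def)
  finally show ?thesis .
qed

section \<open>The resultant as a product over zeros\<close>

lemma prod_mset_const_mult:
  "(\<Prod>x\<in>#A. c * f x) = c ^ size A * (\<Prod>x\<in>#A. f x)" for c :: "'a :: comm_monoid_mult"
  by (simp add: prod_mset.distrib)

text \<open>Up to powers of the leading coefficients, both sides are the double product of
  \<open>x - y\<close> over the zeros \<open>x\<close> of \<open>f\<close> and \<open>y\<close> of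
  \<open>g\<close>; reversing every difference gives the sign.\<close>

lemma prod_proots_swap:
  fixes f g :: "'a :: alg_closed_field poly"
  shows "lead_coeff f ^ degree g * (\<Prod>x\<in>#proots f. poly g x) =
    (-1) ^ (degree f * degree g) * (lead_coeff g ^ degree f * (\<Prod>y\<in>#proots g. poly f y))"
proof -
  let ?c = "lead_coeff f" and ?d = "lead_coeff g" and ?A = "proots f" and ?B = "proots g"
  have neg: "(\<Prod>x\<in>#?A. y - x) = (-1) ^ degree f * (\<Prod>x\<in>#?A. x - y)" for y
    using prod_mset_const_mult[of "-1" "\<lambda>x. x - y" ?A] by (simp add: size_proots_alg_closed)
  have "(\<Prod>y\<in>#?B. poly f y) = ?c ^ degree g * (-1) ^ (degree f * degree g) * (\<Prod>y\<in>#?B. \<Prod>x\<in>#?A. x - y)"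
    by (simp add: poly_eq_prod_proots[of f] neg prod_mset_const_mult size_proots_alg_closed
        mult.assoc flip: power_mult)
  moreover have "(\<Prod>x\<in>#?A. poly g x) = ?d ^ degree f * (\<Prod>x\<in>#?A. \<Prod>y\<in>#?B. x - y)"
    by (simp add: poly_eq_prod_proots[of g] prod_mset_const_mult size_proots_alg_closed)
  moreover have "(\<Prod>x\<in>#?A. \<Prod>y\<in>#?B. x - y) = (\<Prod>y\<in>#?B. \<Prod>x\<in>#?A. x - y)"
    by (rule prod_mset.swap)
  moreover have "(-1) ^ n * ((-1) ^ n * z) = z" for n and z :: 'a
    by (simp flip: mult.assoc power_add)
  ultimately show ?thesis
    by (simp add: ac_simps)
qed

text \<open>One step of the Euclidean algorithm for resultants, read off from the 0-th
  subresultant.\<close>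

lemma resultant_add_mult:
  fixes f b g h :: "'a :: idom poly"
  assumes fgh: "f + b * g = h" and le: "degree g \<le> degree f" and less: "degree h < degree g"
  shows "resultant f g =
    (-1) ^ (degree f * degree g) * lead_coeff g ^ (degree f - degree h) * resultant g h"
proof (cases "degree h = 0")
  case False
  then show ?thesis
    using BT_lemma_1_12[OF fgh le disjI1[OF less], of 0] unfolding subresultant_resultant
    by simp
next
  case True
  then obtain c where h: "h = [:c:]" by (rule degree_eq_zeroE)
  \<comment> \<open>For constant \<open>h\<close> the subresultant is a multiple of \<open>h\<close>
    itself: \<open>c ^ (degree g - 1)\<close> times \<open>c\<close> gives
    \<open>c ^ degree g\<close>, the resultant of \<open>g\<close> and \<open>[:c:]\<close>.\<close>
  have "[:resultant f g:] = [:(- 1) ^ (degree f * degree g) * lead_coeff g ^ degree f * c ^ degree g:]"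
    using BT_lemma_1_13[OF fgh le disjI1[OF less] disjI1[OF less]] less
    unfolding True unfolding subresultant_resultant unfolding h
    by (simp add: power_eq_if[of c "degree g"])
  with True h show ?thesis by simp
qed

text \<open>Induction along the Euclidean algorithm: \<open>f\<close> and \<open>f mod g\<close>
  agree at the zeros of \<open>g\<close>, and exchanging the arguments produces the same sign in the
  resultant and in the product.\<close>

theorem resultant_eq_prod_proots:
  fixes f g :: "'a :: alg_closed_field poly"
  assumes "f \<noteq> 0" "g \<noteq> 0"
  shows "resultant f g = lead_coeff f ^ degree g * (\<Prod>x\<in>#proots f. poly g x)"
  using assms
proof (induction "degree g" arbitrary: f g rule: less_induct)
  case less
  have swap: "resultant f g = lead_coeff f ^ degree g * (\<Prod>x\<in>#proots f. poly g x)"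
    if "resultant g f = lead_coeff g ^ degree f * (\<Prod>x\<in>#proots g. poly f x)"
    using that by (simp add: resultant_swap[of f g] prod_proots_swap[of f g])
  consider "degree g = 0" | "degree f < degree g" | "0 < degree g" "degree g \<le> degree f"
    by linarith
  then show ?case
  proof cases
    case 1
    then obtain c where "g = [:c:]" by (rule degree_eq_zeroE)
    moreover have "poly [:c:] = (\<lambda>_. c)"
      by auto
    ultimately show ?thesis
      by (simp add: size_proots_alg_closed image_mset_const_eq)
  next
    case 2
    then show ?thesis using less by (intro swap)
  next
    case 3
    define r where "r = f mod g"
    have "g \<noteq> 0" by fact
    have fr: "f + - (f div g) * g = r"
      by (simp add: r_def minus_div_mult_eq_mod)
    have r: "degree r < degree g"
      using degree_mod_less[OF \<open>g \<noteq> 0\<close>, of f] 3 by (auto simp: r_def)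
    have res: "resultant g r = lead_coeff g ^ degree r * (\<Prod>y\<in>#proots g. poly r y)"
    \<comment> \<open>The induction hypothesis excludes a zero remainder. Then both sides vanish,
      since \<open>g\<close> has positive degree and so has a zero.\<close>
    proof (cases "r = 0")
      case True
      have "0 < size (proots g)"
        using 3 by (simp add: size_proots_alg_closed)
      then show ?thesis
        using True 3 by simp
    qed (use less r in blast)
    have "poly r y = poly f y" if "y \<in># proots g" for y
      using that \<open>g \<noteq> 0\<close> by (simp flip: fr)
    then have "(\<Prod>y\<in>#proots g. poly r y) = (\<Prod>y\<in>#proots g. poly f y)"
      by (simp cong: image_mset_cong)
    moreover have "lead_coeff g ^ (degree f - degree r) * lead_coeff g ^ degree r = lead_coeff g ^ degree f"
      using r 3 by (simp flip: power_add)
    ultimately have "resultant f g = (-1) ^ (degree f * degree g) *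
        (lead_coeff g ^ degree f * (\<Prod>y\<in>#proots g. poly f y))"
      by (simp add: resultant_add_mult[OF fr 3(2) r] res mult.assoc flip: mult.assoc[of "lead_coeff g ^ _"])
    then show ?thesis
      by (simp add: prod_proots_swap[of f g])
  qed
qed

section \<open>The effect of one new zero on the product\<close>

lemma prod_proots_monic_cong:
  fixes f f' g t :: "'a :: alg_closed_field poly"
  assumes "f' = f + t * g" "lead_coeff f = 1" "lead_coeff f' = 1" "degree f' = degree f"
  shows "(\<Prod>x\<in>#proots f'. poly g x) = (\<Prod>x\<in>#proots f. poly g x)"
proof (cases "g = 0")
  case False
  \<comment> \<open>\<open>f\<close> and \<open>f'\<close> are congruent modulo \<open>g\<close>, so
    they agree at its zeros; equal degrees and leading coefficient 1 make the factors in
    \<open>prod_proots_swap\<close> match.\<close>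
  have "(\<Prod>y\<in>#proots g. poly f' y) = (\<Prod>y\<in>#proots g. poly f y)"
    using False by (intro arg_cong[of _ _ prod_mset] image_mset_cong) (simp add: assms(1))
  then show ?thesis
    using prod_proots_swap[of f g] prod_proots_swap[of f' g] assms by simp
qed (use assms in simp)

lemma degree_lead_coeff_monic:
  assumes "degree p \<le> n" "coeff p n = 1"
  shows "degree p = n" "lead_coeff p = (1 :: 'a :: zero_neq_one)"
proof -
  show "degree p = n"
    using assms le_degree[of p n] by simp
  with assms show "lead_coeff p = 1" by simp
qed

text \<open>
  With an even number of zeros \<open>P\<close> has exact degree and the resultant is a product over the zeros
  of \<open>P\<close>; with an odd number the same holds for \<open>Q\<close>. The other polynomial may drop in degree or
  vanish.
\<close>

lemma prod_proots_even_step: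
  fixes P Q :: "'a :: alg_closed_field poly" and c :: 'a
  assumes P: "degree P \<le> n" "coeff P n = 1" and Q: "degree Q \<le> n" "coeff Q n = 0"
  defines "Q' \<equiv> P - smult c Q"
  shows "(\<Prod>y\<in>#proots Q'. poly (pCons 0 Q - smult c P) y) =
    (-1) ^ n * poly Q' (c\<^sup>2) * (\<Prod>x\<in>#proots P. poly Q x)"
proof -
  have Q': "degree Q' \<le> n" "coeff Q' n = 1"
    using P Q by (auto simp: Q'_def intro!: degree_diff_le order.trans[OF degree_smult_le])
  note mP = degree_lead_coeff_monic[OF P] and mQ' = degree_lead_coeff_monic[OF Q']
  have "Q' \<noteq> 0" using Q' by auto
  \<comment> \<open>The sign is split off so that the remaining factors \<open>c\<^sup>2 - y\<close>
    multiply to the value of the monic \<open>Q'\<close> at \<open>c\<^sup>2\<close>.\<close>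
  have "poly (pCons 0 Q - smult c P) y = - 1 * (c\<^sup>2 - y) * poly Q y" if "y \<in># proots Q'" for y
  proof -
    have "poly P y = c * poly Q y"
      using that \<open>Q' \<noteq> 0\<close> by (simp add: Q'_def)
    then show ?thesis by (simp add: algebra_simps power2_eq_square)
  qed
  then have "(\<Prod>y\<in>#proots Q'. poly (pCons 0 Q - smult c P) y) =
      (\<Prod>y\<in>#proots Q'. - 1 * (c\<^sup>2 - y) * poly Q y)"
    by (intro arg_cong[of _ _ prod_mset] image_mset_cong)
  also have "\<dots> = (-1) ^ n * (\<Prod>y\<in>#proots Q'. c\<^sup>2 - y) * (\<Prod>y\<in>#proots Q'. poly Q y)"
    using mQ' by (simp only: prod_mset.distrib prod_mset_constant image_mset_const_eq size_proots_alg_closed) simp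
  also have "(\<Prod>y\<in>#proots Q'. c\<^sup>2 - y) = poly Q' (c\<^sup>2)"
    using poly_eq_prod_proots[of Q' "c\<^sup>2"] mQ' by simp
  also have "(\<Prod>y\<in>#proots Q'. poly Q y) = (\<Prod>x\<in>#proots P. poly Q x)"
    using mP mQ' by (intro prod_proots_monic_cong[of _ _ "[:-c:]"]) (simp_all add: Q'_def)
  finally show ?thesis .
qed

lemma prod_proots_odd_step:
  fixes P Q :: "'a :: alg_closed_field poly" and c :: 'a
  assumes Q: "degree Q \<le> n" "coeff Q n = 1" and P: "degree P \<le> n"
  defines "Q' \<equiv> P - smult c Q"
  shows "(\<Prod>x\<in>#proots (pCons 0 Q - smult c P). poly Q' x) =
    poly Q' (c\<^sup>2) * (\<Prod>y\<in>#proots Q. poly P y)"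
proof -
  have "Q \<noteq> 0" using Q by auto
  \<comment> \<open>The new first polynomial is congruent to \<open>f\<close> modulo
    \<open>Q'\<close>, and the zeros of \<open>f\<close> are \<open>c\<^sup>2\<close> and those of
    \<open>Q\<close>, where \<open>Q'\<close> agrees with \<open>P\<close>.\<close>
  define f where "f = [:-(c\<^sup>2), 1:] * Q"
  have eq: "pCons 0 Q - smult c P = f + [:-c:] * Q'"
    by (simp add: f_def Q'_def algebra_simps power2_eq_square smult_diff_right)
  have P': "degree (pCons 0 Q - smult c P) \<le> Suc n" "coeff (pCons 0 Q - smult c P) (Suc n) = 1"
    using Q P by (auto intro!: degree_diff_le order.trans[OF degree_smult_le] simp: degree_pCons_eq_if coeff_eq_0)
  have f: "degree f \<le> Suc n" "coeff f (Suc n) = 1"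
    using Q by (auto simp: f_def coeff_eq_0 intro!: degree_diff_le order.trans[OF degree_smult_le])
  have "(\<Prod>x\<in>#proots (pCons 0 Q - smult c P). poly Q' x) = (\<Prod>x\<in>#proots f. poly Q' x)"
    using degree_lead_coeff_monic[OF P'] degree_lead_coeff_monic[OF f]
    by (intro prod_proots_monic_cong[OF eq]) simp_all
  also have "\<dots> = poly Q' (c\<^sup>2) * (\<Prod>y\<in>#proots Q. poly Q' y)"
    using \<open>Q \<noteq> 0\<close> proots_linear_factor[of "-(c\<^sup>2)"]
    unfolding f_def by (subst proots_mult) auto
  also have "(\<Prod>y\<in>#proots Q. poly Q' y) = (\<Prod>y\<in>#proots Q. poly P y)"
    using \<open>Q \<noteq> 0\<close> by (intro arg_cong[of _ _ prod_mset] image_mset_cong) (simp add: Q'_def)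
  finally show ?thesis .
qed

section \<open>Even and odd parts of a polynomial built from its zeros\<close>

lemma prod_pairs_Suc:
  fixes f :: "nat \<Rightarrow> nat \<Rightarrow> 'a :: comm_monoid_mult"
  shows "(\<Prod>(i, k)\<in>{(i, k). 1 \<le> i \<and> i < k \<and> k \<le> Suc n}. f i k) =
    (\<Prod>(i, k)\<in>{(i, k). 1 \<le> i \<and> i < k \<and> k \<le> n}. f i k) * (\<Prod>i=1..n. f i (Suc n))"
proof -
  have split: "{(i, k). 1 \<le> i \<and> i < k \<and> k \<le> Suc n} =
      {(i, k). 1 \<le> i \<and> i < k \<and> k \<le> n} \<union> (\<lambda>i. (i, Suc n)) ` {1..n}"
    by (auto simp: le_Suc_eq)
  have "finite {(i, k). 1 \<le> i \<and> i < k \<and> k \<le> n}"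
    by (rule finite_subset[of _ "{1..n} \<times> {1..n}"]) auto
  then show ?thesis
    unfolding split by (subst prod.union_disjoint) (auto simp: prod.reindex inj_on_def)
qed

definition even_odd_poly :: "'a :: comm_ring_1 poly \<Rightarrow> 'a poly \<Rightarrow> 'a poly" where
  "even_odd_poly P Q = pcompose P (monom 1 2) + monom 1 1 * pcompose Q (monom 1 2)"

lemma poly_even_odd_poly: "poly (even_odd_poly P Q) x = poly P (x\<^sup>2) + x * poly Q (x\<^sup>2)"
  by (simp add: even_odd_poly_def poly_pcompose poly_monom)

lemma linear_mult_even_odd_poly:
  "[:-c, 1:] * even_odd_poly P Q = even_odd_poly (pCons 0 Q - smult c P) (P - smult c Q)"
proof -
  have "pcompose (pCons 0 Q) (monom 1 2) = monom 1 1 * (monom 1 1 * pcompose Q (monom 1 2))"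
    by (simp add: pcompose_pCons mult_monom numeral_2_eq_2 flip: mult.assoc)
  moreover have "[:-c, 1:] = monom 1 1 - [:c:]"
    by (simp add: monom_altdef)
  ultimately show ?thesis
    by (simp only: even_odd_poly_def pcompose_diff pcompose_smult left_diff_distrib
        right_diff_distrib distrib_left mult_smult_right)
      (simp add: smult_add_right)
qed

text \<open>Even and odd indices separate the two parts, so \<open>P\<close> and \<open>Q\<close>
  can be recovered from the combined polynomial.\<close>

lemma coeff_even_odd_poly:
  "coeff (even_odd_poly P Q) (2 * i) = coeff P i"
  "coeff (even_odd_poly P Q) (2 * i + 1) = coeff Q i"
proof -
  have coeff: "coeff (pcompose R (monom 1 2)) (2 * k) = coeff R k"
    "coeff (pcompose R (monom 1 2)) (2 * k + 1) = 0" for R :: "'a poly" and k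
    using coeff_pcompose_monom[of 0 2 R k] coeff_pcompose_monom[of 1 2 R k] by simp_all
  show "coeff (even_odd_poly P Q) (2 * i) = coeff P i"
  proof (cases i)
    case 0
    show ?thesis
      unfolding even_odd_poly_def coeff_add coeff coeff_monom_mult by (simp add: 0)
  next
    case (Suc k)
    then have "2 * i - 1 = 2 * k + 1" by simp
    then show ?thesis
      unfolding even_odd_poly_def coeff_add coeff coeff_monom_mult by (simp only: coeff) simp
  qed
  show "coeff (even_odd_poly P Q) (2 * i + 1) = coeff Q i"
    unfolding even_odd_poly_def coeff_add coeff coeff_monom_mult by (simp add: coeff(1))
qed

text \<open>Zeros are added in pairs, \<open>c\<close> by the even step and \<open>d\<close> by the
  odd one, which restores the shape with \<open>P\<close> monic of exact degree and the top
  coefficient of \<open>Q\<close> zero.\<close>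

lemma prod_proots_even_odd_parts:
  fixes z :: "nat \<Rightarrow> 'a :: alg_closed_field"
  obtains P Q where "degree P \<le> n" "coeff P n = 1" "degree Q \<le> n" "coeff Q n = 0"
    "(\<Prod>i=1..2 * n. [:- z i, 1:]) = even_odd_poly P Q"
    "(\<Prod>x\<in>#proots P. poly Q x) = (-1) ^ (n * (n + 1) div 2) *
      (\<Prod>(i, k)\<in>{(i, k). 1 \<le> i \<and> i < k \<and> k \<le> 2 * n}. z i + z k)"
proof (induction n arbitrary: thesis)
  case 0
  have empty: "{(i, k). 1 \<le> i \<and> i < k \<and> k \<le> 2 * 0} = ({} :: (nat \<times> nat) set)"
    by auto
  show ?case
    by (rule 0[of 1 0]) (unfold empty, simp_all add: even_odd_poly_def)
next
  case (Suc n)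
  obtain P Q where P: "degree P \<le> n" "coeff P n = 1" and Q: "degree Q \<le> n" "coeff Q n = 0"
    and h: "(\<Prod>i=1..2 * n. [:- z i, 1:]) = even_odd_poly P Q"
    and IH: "(\<Prod>x\<in>#proots P. poly Q x) = (-1) ^ (n * (n + 1) div 2) *
      (\<Prod>(i, k)\<in>{(i, k). 1 \<le> i \<and> i < k \<and> k \<le> 2 * n}. z i + z k)"
    by (rule Suc.IH)
  define N where "N = 2 * n"
  define c where "c = z (Suc N)"
  define d where "d = z (Suc (Suc N))"
  define P1 where "P1 = pCons 0 Q - smult c P"
  define Q1 where "Q1 = P - smult c Q"
  define P2 where "P2 = pCons 0 Q1 - smult d P1"
  define Q2 where "Q2 = P1 - smult d Q1"
  note h = h[folded N_def] and IH = IH[folded N_def]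
  have h1: "(\<Prod>i=1..Suc N. [:- z i, 1:]) = even_odd_poly P1 Q1"
    unfolding P1_def Q1_def linear_mult_even_odd_poly[symmetric] h[symmetric] c_def
    by (simp only: prod.nat_ivl_Suc' le_add1 plus_1_eq_Suc)
  have h2: "(\<Prod>i=1..Suc (Suc N). [:- z i, 1:]) = even_odd_poly P2 Q2"
    unfolding P2_def Q2_def linear_mult_even_odd_poly[symmetric] h1[symmetric] d_def
    by (simp only: prod.nat_ivl_Suc' le_add1 plus_1_eq_Suc)
  have Q1: "degree Q1 \<le> n" "coeff Q1 n = 1" 
    using P Q by (auto simp: Q1_def intro!: degree_diff_le order.trans[OF degree_smult_le])
  \<comment> \<open>The vanishing coefficient of \<open>Q\<close> at \<open>n\<close> leaves room
    for the shift. Stating it by coefficients also covers \<open>n = 0\<close>, where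
    \<open>Q = 0\<close>.\<close>
  have "coeff (pCons 0 Q) i = 0" if "n < i" for i
    using that Q by (cases i) (auto simp: less_Suc_eq_le le_less coeff_eq_0)
  then have "degree (pCons 0 Q) \<le> n"
    by (intro degree_le) auto
  then have P1: "degree P1 \<le> n"
    using P unfolding P1_def by (intro degree_diff_le order.trans[OF degree_smult_le])
  have P2: "degree P2 \<le> Suc n" "coeff P2 (Suc n) = 1"
    and Q2: "degree Q2 \<le> Suc n" "coeff Q2 (Suc n) = 0"
    using P1 Q1
    by (auto simp: P2_def Q2_def coeff_eq_0 degree_pCons_eq_if
        intro!: degree_diff_le order.trans[OF degree_smult_le])
  \<comment> \<open>The new factors of the pair product are values at \<open>- w\<close>: no sign
    for the even count \<open>N\<close>, a minus sign for \<open>Suc N\<close>.\<close>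
  have at_neg: "(\<Prod>i=1..k. z i + w) = (-1) ^ k * poly (\<Prod>i=1..k. [:- z i, 1:]) (- w)" for k w
    by (induction k) (simp_all add: algebra_simps)
  have p1: "(\<Prod>i=1..N. z i + c) = poly Q1 (c\<^sup>2)"
    unfolding at_neg h poly_even_odd_poly by (simp add: Q1_def N_def)
  have p2: "(\<Prod>i=1..Suc N. z i + d) = - poly Q2 (d\<^sup>2)"
    unfolding at_neg h1 poly_even_odd_poly by (simp add: Q2_def N_def)
  have "(\<Prod>x\<in>#proots P2. poly Q2 x) = poly Q2 (d\<^sup>2) * (\<Prod>y\<in>#proots Q1. poly P1 y)"
    unfolding P2_def Q2_def by (rule prod_proots_odd_step[OF Q1 P1])
  also have "(\<Prod>y\<in>#proots Q1. poly P1 y) = (-1) ^ n * poly Q1 (c\<^sup>2) * (\<Prod>x\<in>#proots P. poly Q x)"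
    unfolding P1_def Q1_def by (rule prod_proots_even_step[OF P Q])
  finally have "(\<Prod>x\<in>#proots P2. poly Q2 x) = (-1) ^ (n * (n + 1) div 2 + n + 1) *
     (\<Prod>(i, k)\<in>{(i, k). 1 \<le> i \<and> i < k \<and> k \<le> Suc (Suc N)}. z i + z k)"
    unfolding prod_pairs_Suc[of "\<lambda>i k. z i + z k"] IH
    using p1 p2 by (simp add: c_def d_def power_add del: prod.cl_ivl_Suc)
  moreover have "n * (n + 1) div 2 + n + 1 = Suc n * (Suc n + 1) div 2"
    by simp
  ultimately show ?case
    using P2 Q2 h2 by (intro Suc.prems[of P2 Q2]) (simp_all add: N_def)
qed

section \<open>Transfer to the given polynomials by scaling\<close>

theorem theorem1p14:
  fixes a b z :: "nat \<Rightarrow> complex" and p q h :: "complex poly" and m n :: nat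
  assumes p_def: "p = (\<Sum>i\<le>n. monom (a i) (n - i))"
    and q_def: "q = (\<Sum>i\<le>n. monom (b i) (n - i))"
    and "a 0 \<noteq> 0"
    and "degree p = n"
    and "degree q = m"
    and "m < n"
    and "b (n - m) \<noteq> 0"
    and h_def: "h = pcompose p (monom 1 2) + monom 1 1 * pcompose q (monom 1 2)"
    and zeros: "proots h = image_mset z (mset_set {1..2 * n})"
  shows "resultant p q =
    (-1) ^ (n * (n + 1) div 2) * a 0 ^ (m + n) *
    (\<Prod>(i, k)\<in>{(i, k). 1 \<le> i \<and> i < k \<and> k \<le> 2 * n}. z i + z k)"
proof -
  obtain P Q where P: "degree P \<le> n" "coeff P n = 1"
    and split: "(\<Prod>i=1..2 * n. [:- z i, 1:]) = even_odd_poly P Q"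
    and PQ: "(\<Prod>x\<in>#proots P. poly Q x) = (-1) ^ (n * (n + 1) div 2) *
      (\<Prod>(i, k)\<in>{(i, k). 1 \<le> i \<and> i < k \<and> k \<le> 2 * n}. z i + z k)"
    by (rule prod_proots_even_odd_parts)
  define l where "l = lead_coeff h"
  have h: "h = even_odd_poly p q"
    by (simp add: h_def even_odd_poly_def)
  have "h = smult l (\<Prod>x\<in>#proots h. [:-x, 1:])"
    unfolding l_def by (rule alg_closed_decompose)
  then have "even_odd_poly p q = smult l (even_odd_poly P Q)"
    by (simp add: zeros image_mset.compositionality o_def flip: split h prod_unfold_prod_mset)
  then have coeff: "coeff p i = l * coeff P i" "coeff q i = l * coeff Q i" for i
    by (metis coeff_even_odd_poly(1) coeff_smult, metis coeff_even_odd_poly(2) coeff_smult)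
  have "coeff p n = (\<Sum>i\<le>n. if i = 0 then a i else 0)"
    unfolding p_def coeff_sum by (intro sum.cong) auto
  then have l: "l = a 0"
    using coeff(1)[of n] P by simp
  have p: "p = smult (a 0) P" and q: "q = smult (a 0) Q"
    by (auto intro!: poly_eqI simp: coeff l)
  \<comment> \<open>For \<open>m = 0\<close> the degree alone does not exclude \<open>q = 0\<close>,
    as the zero polynomial has degree 0; the coefficient \<open>b (n - m)\<close> does.\<close>
  have "coeff q m = (\<Sum>i\<le>n. if i = n - m then b i else 0)"
    unfolding q_def coeff_sum using \<open>m < n\<close> by (intro sum.cong) auto
  then have "q \<noteq> 0" using \<open>b (n - m) \<noteq> 0\<close> by auto
  moreover have "p \<noteq> 0" using assms by auto
  ultimately have "resultant p q = lead_coeff p ^ m * (\<Prod>x\<in>#proots p. poly q x)"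
    using resultant_eq_prod_proots \<open>degree q = m\<close> by blast
  also have "lead_coeff p = a 0"
    using coeff(1)[of n] P \<open>degree p = n\<close> by (simp add: l)
  \<comment> \<open>Scaling keeps the \<open>n\<close> zeros of \<open>P\<close>, and each value of
    \<open>q\<close> carries one factor \<open>a 0\<close>; the other \<open>m\<close> factors come
    from \<open>lead_coeff p\<close>.\<close>
  also have "(\<Prod>x\<in>#proots p. poly q x) = a 0 ^ n * (\<Prod>x\<in>#proots P. poly Q x)"
    using \<open>a 0 \<noteq> 0\<close> degree_lead_coeff_monic(1)[OF P]
    by (simp add: p q prod_mset_const_mult size_proots_alg_closed)
  finally show ?thesis
    by (simp add: PQ power_add)
qed

end
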